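(* When $m(x)$ is supermodular, there exist at most $n+1$ core facets for $\operatorname{conv}(G)$, and all such facets, subject to repetition (i.e., some of the listed inequalities may coincide), are $$\frac{u\,m(x^0)-\ell\,m(x^n)}{u-\ell}+\sum_{j=1}^n\left(\frac{m(x^j)-m(x^{j-1})}{u-\ell}\right)x_j-y\ge 0,$$ and $$-m(x^k)-\left(\frac{m(x^k)-m(x^{k-1})}{u-\ell}\right)\left(\sum_{j=1}^nx_j-[ku+(n-k)\ell]\right)+y\ge 0,\qquad k\in N.$$
   Context: Let $n\ge 2$, $N=\{1,\dots,n\}$, and let $\ell<u$ be real numbers. Let $X=\{x\in\mathbb{R}^n:\ell\le x_j\le u,\ j\in N\}$. For real coefficients $c_2,\dots,c_n$, not all zero, let $m(x)=\sum_{i=2}^n c_i\sum_{J\subseteq N,\ |J|=i}\prod_{j\in J}x_j$, and let $G=\{(x,y)\in\mathbb{R}^n\times\mathbb{R}: x\in X,\ y=m(x)\}$. The set $\operatorname{conv}(G)$ is a polytope of dimension $n+1$. For $k=0,\dots,n$, $x^k\in\mathbb{R}^n$ denotes the point whose first $k$ entries equal $u$ and whose last $n-k$ entries equal $\ell$ (superscripts are not powers). "$m(x)$ is supermodular" means supermodular over the $2^n$ extreme points of $X$: the set function $f(A)=m(x)$, with $x_j=u$ for $j\in A$ and $x_j=\ell$ for $j\notin A$, satisfies $f(S\cup\{r\})-f(S)\le f(S\cup\{r,t\})-f(S\cup\{t\})$ for all distinct $r,t\in N$ and $S\subseteq N\setminus\{r,t\}$; by symmetry of $m$ this is equivalent to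 $m(x^k)-m(x^{k-1})\le m(x^{k+1})-m(x^k)$ for all $k\in\{1,\dots,n-1\}$. A core inequality is a linear inequality $\beta_0+\sum_{j=1}^n\beta_jx_j+\beta' y\ge 0$ with $\beta'\in\{-1,1\}$ and $\beta_1\le\cdots\le\beta_n$; it is a core facet for $\operatorname{conv}(G)$ if it is satisfied by all points of $\operatorname{conv}(G)$ and the set of points of $\operatorname{conv}(G)$ satisfying it with equality is a facet of $\operatorname{conv}(G)$. *)

theory Defs
  imports "HOL-Analysis.Analysis"
begin

text \<open>
  The index set \<open>N = {1,\<dots>,n}\<close> is a type \<open>'n\<close> of class \<open>finite\<close> and \<open>linorder\<close>
  with \<open>n = CARD('n)\<close>.  Up to order isomorphism there is exactly one such type for
  each \<open>n \<ge> 1\<close>; \<open>index j \<in> {1..n}\<close> is the number in \<open>N\<close> that \<open>j\<close> stands for.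
\<close>

definition index :: "'n::{finite,linorder} \<Rightarrow> nat" where
  "index j = card {i. i \<le> j}"

definition box_set :: "real \<Rightarrow> real \<Rightarrow> (real^'n::finite) set" where
  "box_set l u = {x. \<forall>j. l \<le> x $ j \<and> x $ j \<le> u}"

definition sym_multilinear :: "(nat \<Rightarrow> real) \<Rightarrow> real^'n::finite \<Rightarrow> real" where
  "sym_multilinear c x =
     (\<Sum>i = 2..CARD('n). c i * (\<Sum>J | J \<subseteq> UNIV \<and> card J = i. \<Prod>j\<in>J. x $ j))"

definition graph_on_box ::
    "real \<Rightarrow> real \<Rightarrow> (real^'n::finite \<Rightarrow> real) \<Rightarrow> ((real^'n) \<times> real) set" where
  "graph_on_box l u m = {(x, y). x \<in> box_set l u \<and> y = m x}"

definition vertex :: "real \<Rightarrow> real \<Rightarrow> ('n::finite) set \<Rightarrow> real^'n" where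
  "vertex l u A = (\<chi> j. if j \<in> A then u else l)"

definition stair_point :: "real \<Rightarrow> real \<Rightarrow> nat \<Rightarrow> real^'n::{finite,linorder}" where
  "stair_point l u k = (\<chi> j. if index j \<le> k then u else l)"

definition supermodular_on_vertices ::
    "real \<Rightarrow> real \<Rightarrow> (real^'n::finite \<Rightarrow> real) \<Rightarrow> bool" where
  "supermodular_on_vertices l u m \<longleftrightarrow>
     (let f = (\<lambda>A. m (vertex l u A)) in
      \<forall>r t S. r \<noteq> t \<and> S \<subseteq> UNIV - {r, t} \<longrightarrow>
        f (S \<union> {r}) - f S \<le> f (S \<union> {r, t}) - f (S \<union> {t}))"

text \<open>
  A linear inequality \<open>L (x, y) \<ge> 0\<close> is represented by its left-hand side \<open>L\<close>.  As an
  affine function determines its coefficients, two inequalities coincide iff their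
  coefficients do.
\<close>

definition core_inequality :: "((real^'n::{finite,linorder}) \<times> real \<Rightarrow> real) \<Rightarrow> bool" where
  "core_inequality L \<longleftrightarrow>
     (\<exists>\<beta>0 \<beta> \<beta>'.
        \<beta>' \<in> {-1, 1} \<and> (\<forall>i j. i \<le> j \<longrightarrow> \<beta> $ i \<le> \<beta> $ j) \<and>
        L = (\<lambda>(x, y). \<beta>0 + (\<Sum>j\<in>UNIV. \<beta> $ j * x $ j) + \<beta>' * y))"

definition core_facet ::
    "((real^'n::{finite,linorder}) \<times> real) set \<Rightarrow> ((real^'n::{finite,linorder}) \<times> real \<Rightarrow> real) \<Rightarrow> bool" where
  "core_facet P L \<longleftrightarrow>
     core_inequality L \<and> (\<forall>p\<in>P. L p \<ge> 0) \<and> {p \<in> P. L p = 0} facet_of P"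

definition upper_ineq ::
    "real \<Rightarrow> real \<Rightarrow> (real^'n::{finite,linorder} \<Rightarrow> real) \<Rightarrow> (real^'n::{finite,linorder}) \<times> real \<Rightarrow> real" where
  "upper_ineq l u m = (\<lambda>(x, y).
     (u * m (stair_point l u 0) - l * m (stair_point l u CARD('n))) / (u - l)
     + (\<Sum>j\<in>UNIV. ((m (stair_point l u (index j)) - m (stair_point l u (index j - 1)))
                    / (u - l)) * x $ j)
     - y)"

definition lower_ineq ::
    "real \<Rightarrow> real \<Rightarrow> (real^'n::{finite,linorder} \<Rightarrow> real) \<Rightarrow> nat \<Rightarrow> (real^'n::{finite,linorder}) \<times> real \<Rightarrow> real" where
  "lower_ineq l u m k = (\<lambda>(x, y).
     - m (stair_point l u k)
     - ((m (stair_point l u k) - m (stair_point l u (k - 1))) / (u - l))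
       * ((\<Sum>j\<in>UNIV. x $ j) - (real k * u + (real CARD('n) - real k) * l))
     + y)"

end

theory Submission
  imports Defs
begin

text \<open>
  Since \<open>m\<close> is symmetric and affine in each coordinate, \<open>conv(G)\<close> is the convex hull of the
  lifted vertices \<open>(vertex l u A, F (card A))\<close>, where \<open>F k = m(x\<^sup>k)\<close>, and supermodularity says
  that \<open>F\<close> is convex.  The nonlinearity of \<open>m\<close> makes the hull full-dimensional, because on the
  diagonal of the box \<open>m\<close> is a polynomial of degree at least two (\<open>aff_dim_graph\<close>).

  A core inequality is thus determined by its slack, a set function
  \<open>h A = g + sum d A \<plusminus> F (card A)\<close>.  It is a facet exactly if \<open>h\<close> is nonnegative and the
  indicator vectors of the tight sets, where \<open>h\<close> vanishes, affinely span the whole space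
  (\<open>core_facet_iff_spanning\<close>).

  With the sign \<open>-\<close> the slack is submodular, so the tight sets form a lattice.  A spanning lattice
  separates any two elements of the index set and therefore contains sets of every size.  As the
  coefficients increase, the tight sets can be taken to be initial segments, whose incidences
  determine all coefficients (\<open>tight_initial_if_spanning\<close>).

  With the sign \<open>+\<close> adding an element of small coefficient to one tight set and removing one of
  large coefficient from another would lower the total slack, so the coefficients are equal.  Then
  the slack is a convex function of the size.  It vanishes at two sizes, hence at two
  consecutive ones, and this leaves one inequality for each \<open>k\<close>
  (\<open>tight_sizes_if_spanning\<close>).
\<close>

section \<open>Initial segments of the index set\<close>

definition initial :: "nat \<Rightarrow> 'n::{finite,linorder} set" where
  "initial k = {j. index j \<le> k}"

lemma strict_mono_index: "strict_mono (index :: 'n::{finite,linorder} \<Rightarrow> nat)"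
proof (rule strict_monoI)
  fix i j :: 'n assume "i < j"
  then have "{k. k \<le> i} \<subseteq> {k. k \<le> j}" "j \<in> {k. k \<le> j} - {k. k \<le> i}" by auto
  then have "{k. k \<le> i} \<subset> {k. k \<le> j}" by blast
  then show "index i < index j" unfolding index_def by (simp add: psubset_card_mono)
qed

lemma index_bounds: "index (j::'n::{finite,linorder}) \<in> {1..CARD('n)}"
  unfolding index_def by (auto simp: Suc_le_eq card_gt_0_iff intro: card_mono)

lemma bij_betw_index: "bij_betw (index :: 'n \<Rightarrow> nat) UNIV {1..CARD('n::{finite,linorder})}"
proof -
  have inj: "inj (index :: 'n \<Rightarrow> nat)"
    using strict_mono_index by (rule strict_mono_imp_inj_on)
  have "index ` (UNIV :: 'n set) = {1..CARD('n)}"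
    by (rule card_subset_eq) (use index_bounds[where 'n='n] in \<open>auto simp: card_image[OF inj]\<close>)
  with inj show ?thesis by (simp add: bij_betw_def)
qed

lemma sum_initial:
  fixes g :: "nat \<Rightarrow> real"
  assumes "k \<le> CARD('n)"
  shows "(\<Sum>j\<in>(initial k :: 'n::{finite,linorder} set). g (index j)) = (\<Sum>i=1..k. g i)"
proof -
  have "bij_betw index (initial k :: 'n set) {1..k}"
    using bij_betw_index[where 'n='n] assms unfolding bij_betw_def initial_def inj_on_def
    by (fastforce simp: set_eq_iff image_iff)
  then show ?thesis by (rule sum.reindex_bij_betw)
qed

lemma card_initial:
  assumes "k \<le> CARD('n)"
  shows "card (initial k :: 'n::{finite,linorder} set) = k"
  using sum_initial[OF assms, of "\<lambda>_. 1"] by simp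

lemma initial_0 [simp]: "initial 0 = ({} :: 'n::{finite,linorder} set)"
  using card_initial[of 0, where 'n='n] by simp

lemma initial_CARD [simp]: "initial CARD('n) = (UNIV :: 'n::{finite,linorder} set)"
  using index_bounds by (auto simp: initial_def)

lemma initial_index_eq:
  "initial (index j) = insert (j::'n::{finite,linorder}) (initial (index j - 1))"
  "j \<notin> initial (index j - 1)"
proof -
  have inj: "index i = index j \<longleftrightarrow> i = j" for i
    using strict_mono_eq[OF strict_mono_index] .
  have pos: "1 \<le> index j" using index_bounds[of j] by simp
  have le: "i \<le> index j \<longleftrightarrow> i = index j \<or> i \<le> index j - 1" for i using pos by linarith
  show "initial (index j) = insert j (initial (index j - 1))"
    unfolding initial_def set_eq_iff insert_iff mem_Collect_eq le inj[symmetric] by simp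
  show "j \<notin> initial (index j - 1)"
    using pos by (auto simp: initial_def)
qed

lemma stair_point_eq_vertex: "stair_point l u k = vertex l u (initial k)"
  by (simp add: stair_point_def vertex_def initial_def)

text \<open>
  Exchanging the elements of \<open>A\<close> outside the initial segment for equally many missing ones
  inside it can only lower a sum of increasing weights.
\<close>

lemma sum_initial_le:
  fixes d :: "'n::{finite,linorder} \<Rightarrow> real"
  assumes "mono d"
  shows "sum d (initial (card A)) \<le> sum d A"
proof (cases "A = {}")
  case False
  let ?B = "initial (card A) :: 'n set"
  have le: "card A \<le> CARD('n)" by (simp add: card_mono)
  have "card A \<in> {1..CARD('n)}" using False le by (simp add: Suc_le_eq card_gt_0_iff)
  \<comment> \<open>The weight of the last element of the initial segment separates the weights given up from
    those gained.\<close>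
  then obtain t :: 'n where t: "index t = card A"
    using bij_betw_index[where 'n='n] by (metis bij_betw_iff_bijections)
  have cB: "card ?B = card A" by (rule card_initial[OF le])
  have "card (?B - A) = card (A - ?B)"
    using cB by (simp add: card_Diff_subset_Int Int_commute)
  have "sum d (?B - A) \<le> real (card (?B - A)) * d t"
  proof (rule sum_bounded_above)
    fix j assume "j \<in> ?B - A"
    then have "\<not> index t < index j" by (simp add: initial_def t)
    then have "j \<le> t" using strict_mono_index strict_mono_less not_le by blast
    then show "d j \<le> d t" using assms by (simp add: monoD)
  qed
  also have "\<dots> = real (card (A - ?B)) * d t"
    using \<open>card (?B - A) = card (A - ?B)\<close> by simp
  also have "\<dots> \<le> sum d (A - ?B)"
  proof (rule sum_bounded_below)
    fix j assume "j \<in> A - ?B"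
    then have "index t < index j" by (simp add: initial_def t)
    then have "t \<le> j" using strict_mono_index strict_mono_less less_imp_le by blast
    then show "d t \<le> d j" using assms by (simp add: monoD)
  qed
  finally have "sum d (?B - A) \<le> sum d (A - ?B)" .
  moreover have "sum d ?B = sum d (?B - A) + sum d (A \<inter> ?B)"
    by (metis Int_commute finite sum.Int_Diff add.commute)
  moreover have "sum d A = sum d (A - ?B) + sum d (A \<inter> ?B)"
    by (metis finite sum.Int_Diff add.commute)
  ultimately show ?thesis by simp
qed simp

section \<open>Convex sequences\<close>

definition convex_upto :: "nat \<Rightarrow> (nat \<Rightarrow> real) \<Rightarrow> bool" where
  "convex_upto n F \<longleftrightarrow> (\<forall>k. k + 2 \<le> n \<longrightarrow> F (k + 1) - F k \<le> F (k + 2) - F (k + 1))"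

lemma convex_upto_step_mono:
  assumes "convex_upto n F" "p \<le> q" "q + 1 \<le> n"
  shows "F (p + 1) - F p \<le> F (q + 1) - F q"
  using assms(2,3)
proof (induction q rule: dec_induct)
  case (step q)
  then have "F (q + 1) - F q \<le> F (q + 2) - F (q + 1)"
    using assms(1) by (simp add: convex_upto_def)
  with step show ?case by simp
qed simp

lemma convex_upto_gap_mono:
  assumes "convex_upto n F" "p \<le> q" "q + s \<le> n"
  shows "F (p + s) - F p \<le> F (q + s) - F q"
  using assms(3)
proof (induction s)
  case (Suc s)
  then show ?case
    using convex_upto_step_mono[OF assms(1), of "p + s" "q + s"] assms(2) by simp
qed simp

text \<open>A convex sequence lies above the line through two consecutive members.\<close>

lemma convex_upto_tangent:
  assumes conv: "convex_upto n F" and k: "k \<in> {1..n}" and a: "a \<le> n"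
  shows "F k + (F k - F (k - 1)) * (real a - real k) \<le> F a"
proof (cases "k \<le> a")
  case True
  then show ?thesis using a
  proof (induction a rule: dec_induct)
    case (step a)
    have "F k - F (k - 1) \<le> F (Suc a) - F a"
      using convex_upto_step_mono[OF conv, of "k - 1" a] step k by auto
    with step show ?case by (simp add: algebra_simps)
  qed simp
next
  case False
  then have "a \<le> k" by simp
  then show ?thesis
  proof (induction a rule: inc_induct)
    case (step a)
    have "F (Suc a) - F a \<le> F k - F (k - 1)"
      using convex_upto_step_mono[OF conv, of a "k - 1"] step k by auto
    with step show ?case by (simp add: algebra_simps)
  qed simp
qed

section \<open>Spanning families of sets\<close>

text \<open>
  In terms of indicator vectors: the only affine functions that vanish on the family are trivial,
  so the indicator vectors affinely span the whole space.
\<close>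

definition spanning :: "'n set set \<Rightarrow> bool" where
  "spanning T \<longleftrightarrow> (\<forall>(a::'n \<Rightarrow> real) d. (\<forall>A\<in>T. sum a A = d) \<longrightarrow> (\<forall>j. a j = 0))"

lemma spanning_obtain_mem:
  assumes "spanning (T :: 'n::finite set set)"
  obtains A where "A \<in> T" "j \<in> A"
proof -
  have "\<exists>A\<in>T. j \<in> A"
  proof (rule ccontr)
    assume no: "\<not> ?thesis"
    have "\<forall>A\<in>T. (\<Sum>i\<in>A. if i = j then 1 else 0::real) = 0"
      using no by (auto intro!: sum.neutral)
    then have "(if j = j then 1 else 0::real) = 0"
      using assms unfolding spanning_def by blast
    then show False by simp
  qed
  then show ?thesis using that by blast
qed

lemma spanning_obtain_not_mem:
  assumes "spanning (T :: 'n::finite set set)"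
  obtains A where "A \<in> T" "j \<notin> A"
proof -
  have "\<exists>A\<in>T. j \<notin> A"
  proof (rule ccontr)
    assume no: "\<not> ?thesis"
    have "\<forall>A\<in>T. (\<Sum>i\<in>A. if i = j then 1 else 0::real) = 1"
      using no by auto
    then have "(if j = j then 1 else 0::real) = 0"
      using assms unfolding spanning_def by blast
    then show False by simp
  qed
  then show ?thesis using that by blast
qed

lemma spanning_obtain_separating:
  assumes "spanning (T :: 'n::finite set set)" "i \<noteq> j"
  obtains A where "A \<in> T" "(i \<in> A) \<noteq> (j \<in> A)"
proof -
  have "\<exists>A\<in>T. (i \<in> A) \<noteq> (j \<in> A)"
  proof (rule ccontr)
    assume no: "\<not> ?thesis"
    define a where "a = (\<lambda>k. (if k = i then 1 else 0) - (if k = j then 1 else 0::real))"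
    have "\<forall>A\<in>T. sum a A = 0"
      using no by (auto simp: a_def sum_subtractf)
    then have "a i = 0"
      using assms unfolding spanning_def by blast
    with assms(2) show False by (simp add: a_def)
  qed
  then show ?thesis using that by blast
qed

lemma spanning_obtain_card_less:
  assumes "spanning (T :: 'n::finite set set)"
  obtains A B where "A \<in> T" "B \<in> T" "card A < card B"
proof -
  have "\<exists>A\<in>T. \<exists>B\<in>T. card A < card B"
  proof (rule ccontr)
    assume no: "\<not> ?thesis"
    then have eq: "card A = card B" if "A \<in> T" "B \<in> T" for A B
      using that by (meson linorder_neqE_nat)
    have "\<exists>d. \<forall>A\<in>T. (\<Sum>i\<in>A. 1::real) = d"
    proof (cases "T = {}")
      case False
      then obtain B where "B \<in> T" by blast
      then have "\<forall>A\<in>T. card A = card B" using eq by blast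
      then have "\<forall>A\<in>T. (\<Sum>i\<in>A. 1::real) = real (card B)" by simp
      then show ?thesis by blast
    qed simp
    then have "(1::real) = 0" using assms unfolding spanning_def by blast
    then show False by simp
  qed
  then show ?thesis using that by blast
qed

text \<open>Adding one element to a member of the family isolates one coefficient.\<close>

lemma spanningI_insert:
  assumes "\<And>j :: 'n::finite. \<exists>A. j \<notin> A \<and> A \<in> T \<and> insert j A \<in> T"
  shows "spanning T"
  unfolding spanning_def
proof (intro allI impI)
  fix a :: "'n \<Rightarrow> real" and d j assume *: "\<forall>A\<in>T. sum a A = d"
  obtain A where A: "j \<notin> A" "A \<in> T" "insert j A \<in> T" using assms by blast
  then have "sum a (insert j A) = sum a A" using * by (metis (full_types))
  with A(1) show "a j = 0" by simp
qed

section \<open>Tight sets of valid inequalities\<close>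

text \<open>
  The slack of an inequality that bounds a convex function of the cardinality from above is
  submodular, and a nonnegative submodular function has a zero set closed under union and
  intersection.  If that lattice of tight sets is spanning, it separates any two elements and
  therefore has a tight set of every size: a smallest tight set above a given one cannot exceed
  it by two elements, since a tight set separating those two would produce a smaller one.  For
  increasing weights the initial segment has the least slack of all sets of its size.
\<close>

lemma tight_initial_if_spanning:
  fixes d :: "'n::{finite,linorder} \<Rightarrow> real"
    and F :: "nat \<Rightarrow> real" and g :: real
  defines "h \<equiv> (\<lambda>A. g + sum d A - F (card A))"
  assumes conv: "convex_upto CARD('n) F" and mono: "mono d"
    and nonneg: "\<And>A. 0 \<le> h A" and span: "spanning {A. h A = 0}"
    and k: "k \<le> CARD('n)"
  shows "h (initial k) = 0"
proof -
  have lattice: "h (A \<union> B) = 0 \<and> h (A \<inter> B) = 0" if "h A = 0" "h B = 0" for A B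
  proof -
    have ci: "card (A \<inter> B) \<le> card A" by (simp add: card_mono)
    have cu: "card A + card B = card (A \<union> B) + card (A \<inter> B)" by (rule card_Un_Int) simp_all
    have cb: "card (A \<inter> B) \<le> card B" by (simp add: card_mono)
    have "card (A \<union> B) \<le> CARD('n)" by (simp add: card_mono)
    then have "F (card (A \<inter> B) + (card A - card (A \<inter> B))) - F (card (A \<inter> B))
        \<le> F (card B + (card A - card (A \<inter> B))) - F (card B)"
      using ci cu cb by (intro convex_upto_gap_mono[OF conv]) auto
    moreover have "card B + (card A - card (A \<inter> B)) = card (A \<union> B)" using ci cu by simp
    ultimately have "F (card A) + F (card B) \<le> F (card (A \<union> B)) + F (card (A \<inter> B))"
      using ci by simp
    moreover have "sum d (A \<union> B) + sum d (A \<inter> B) = sum d A + sum d B"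
      by (simp add: sum.union_inter)
    ultimately have "h (A \<union> B) + h (A \<inter> B) \<le> 0" using that by (simp add: h_def)
    then show ?thesis using nonneg[of "A \<union> B"] nonneg[of "A \<inter> B"] by linarith
  qed
  have "\<exists>T. h T = 0 \<and> card T = k" using k
  proof (induction k)
    case 0
    obtain A where A: "h A = 0" using spanning_obtain_mem[OF span] by blast
    obtain T where T: "h T = 0" "\<And>S. h S = 0 \<Longrightarrow> card T \<le> card S"
      using ex_has_least_nat[of "\<lambda>S. h S = 0" A card] A by blast
    have "j \<notin> T" for j
    proof
      assume "j \<in> T"
      obtain C where C: "h C = 0" "j \<notin> C" using spanning_obtain_not_mem[OF span] by blast
      have "card (C \<inter> T) < card T" using \<open>j \<in> T\<close> C(2) by (intro psubset_card_mono) auto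
      moreover have "card T \<le> card (C \<inter> T)" using lattice[OF C(1) T(1)] T(2) by blast
      ultimately show False by simp
    qed
    then have "T = {}" by blast
    with T(1) show ?case by auto
  next
    case (Suc k)
    then obtain T where T: "h T = 0" "card T = k" by auto
    then have "T \<noteq> UNIV" using Suc.prems by auto
    then obtain j where j: "j \<notin> T" by blast
    obtain C where C: "h C = 0" "j \<in> C" using spanning_obtain_mem[OF span] by blast
    have "h (C \<union> T) = 0 \<and> T \<subset> C \<union> T" using lattice[OF C(1) T(1)] C j by blast
    then obtain B where B: "h B = 0" "T \<subset> B" "\<And>S. h S = 0 \<and> T \<subset> S \<Longrightarrow> card B \<le> card S"
      using ex_has_least_nat[of "\<lambda>S. h S = 0 \<and> T \<subset> S" "C \<union> T" card] by blast
    obtain i where i: "i \<in> B - T" using B(2) by blast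
    have "B \<subseteq> insert i T"
    proof (rule ccontr)
      assume "\<not> ?thesis"
      then obtain i' where i': "i' \<in> B - T" "i' \<noteq> i" by blast
      obtain E where E: "h E = 0" "(i \<in> E) \<noteq> (i' \<in> E)"
        using spanning_obtain_separating[OF span] i'(2) by (metis mem_Collect_eq)
      let ?S = "(E \<inter> B) \<union> T"
      have "h ?S = 0" using lattice B(1) E(1) T(1) by blast
      moreover have "T \<subset> ?S" using E(2) i i' by blast
      ultimately have "card B \<le> card ?S" using B(3) by blast
      moreover have "?S \<subset> B" using E(2) i i' B(2) by blast
      then have "card ?S < card B" by (simp add: psubset_card_mono)
      ultimately show False by simp
    qed
    then have "B = insert i T" using B(2) i by blast
    then have "card B = Suc k" using i T(2) by simp
    with B(1) show ?case by blast
  qed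
  then obtain T where T: "h T = 0" "card T = k" by blast
  have "h (initial k) \<le> h T"
    using sum_initial_le[OF mono, of T] T(2) card_initial[OF k] by (simp add: h_def)
  with T(1) nonneg[of "initial k"] show ?thesis by simp
qed

text \<open>
  For a bound from below the weights must be constant.  Exchanging an element of a tight set for
  a missing one shows that tight sets prefer small weights.  If \<open>d i < d j\<close>, a tight set \<open>A\<close>
  without \<open>i\<close> is then contained in every tight set \<open>B\<close> with \<open>j\<close>, and moving to \<open>A \<union> {i}\<close> and
  \<open>B - {j}\<close> lowers the total slack below zero, by convexity.  With constant weights the slack
  depends convexly on the size alone, and it vanishes at two sizes.
\<close>

lemma tight_sizes_if_spanning:
  fixes d :: "'n::finite \<Rightarrow> real"
    and F :: "nat \<Rightarrow> real" and g :: real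
  defines "h \<equiv> (\<lambda>A. g + sum d A + F (card A))"
  assumes conv: "convex_upto CARD('n) F"
    and nonneg: "\<And>A. 0 \<le> h A" and span: "spanning {A. h A = 0}"
  obtains k where "k \<in> {1..CARD('n)}" "\<And>j. d j = - (F k - F (k - 1))"
    "g - real k * (F k - F (k - 1)) + F k = 0"
proof -
  \<comment> \<open>Exchanging \<open>i\<close> for \<open>j\<close> keeps the size.\<close>
  have exch: "d i \<le> d j" if "h A = 0" "i \<in> A" "j \<notin> A" for A i j
  proof -
    have "card (insert j (A - {i})) = card A"
      using that card_Suc_Diff1[of A i] by simp
    moreover have "sum d (insert j (A - {i})) = sum d A - d i + d j"
      using that by (simp add: sum_diff1)
    ultimately show ?thesis using nonneg[of "insert j (A - {i})"] that(1) by (simp add: h_def)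
  qed
  have const: "\<not> d i < d j" for i j
  proof
    assume ij: "d i < d j"
    obtain A where A: "h A = 0" "i \<notin> A" using spanning_obtain_not_mem[OF span] by blast
    obtain B where B: "h B = 0" "j \<in> B" using spanning_obtain_mem[OF span] by blast
    have "insert i A \<subseteq> B"
    proof
      fix k assume "k \<in> insert i A"
      then have "d k \<le> d i" using exch[OF A(1) _ A(2)] by auto
      then show "k \<in> B" using exch[OF B(1,2), of k] ij by fastforce
    qed
    then have "card (insert i A) \<le> card B" by (simp add: card_mono)
    then have ab: "card A + 1 \<le> card B" using A(2) by simp
    have "card B \<le> CARD('n)" by (simp add: card_mono)
    then have "F (card A + 1) - F (card A) \<le> F (card B) - F (card B - 1)"
      using convex_upto_step_mono[OF conv, of "card A" "card B - 1"] ab by simp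
    moreover have "h (insert i A) = h A + d i + F (card A + 1) - F (card A)"
      using A(2) by (simp add: h_def)
    moreover have "h (B - {j}) = h B - d j + F (card B - 1) - F (card B)"
      using B(2) by (simp add: h_def sum_diff1)
    ultimately have "h (insert i A) + h (B - {j}) < 0" using A(1) B(1) ij by linarith
    then show False using nonneg[of "insert i A"] nonneg[of "B - {j}"] by linarith
  qed
  obtain D where D: "\<And>j. d j = D" using const by (metis linorder_neqE)
  define W where "W = (\<lambda>k. g + real k * D + F k)"
  have hW: "h A = W (card A)" for A by (simp add: h_def W_def D)
  have W_nonneg: "0 \<le> W k" if k: "k \<le> CARD('n)" for k
  proof -
    obtain A :: "'n set" where "card A = k"
      using obtain_subset_with_card_n[OF k] by blast
    then show ?thesis using nonneg[of A] hW by simp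
  qed
  obtain A B where AB: "h A = 0" "h B = 0" "card A < card B"
    using spanning_obtain_card_less[OF span] by blast
  have B_le: "card B \<le> CARD('n)" by (simp add: card_mono)
  \<comment> \<open>By convexity \<open>W\<close>, being nonnegative, cannot rise after its zero \<open>card A\<close> and fall to its
    zero \<open>card B\<close>, so it also vanishes just before \<open>card B\<close>.\<close>
  let ?k = "card B"
  have "F (card A + 1) - F (card A) \<le> F ?k - F (?k - 1)"
    using convex_upto_step_mono[OF conv, of "card A" "?k - 1"] AB(3) B_le by simp
  then have "W (card A + 1) - W (card A) \<le> W ?k - W (?k - 1)"
    using AB(3) by (simp add: W_def of_nat_diff algebra_simps)
  moreover have "W (card A) = 0" "W ?k = 0" using AB(1,2) hW by simp_all
  moreover have "0 \<le> W (card A + 1)" "0 \<le> W (?k - 1)"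
    using AB(3) B_le by (auto intro!: W_nonneg)
  ultimately have 0: "W ?k = 0" "W (?k - 1) = 0" by linarith+
  then have D_eq: "D = - (F ?k - F (?k - 1))"
    using AB(3) by (simp add: W_def of_nat_diff algebra_simps)
  show ?thesis
  proof (rule that)
    show "?k \<in> {1..CARD('n)}" using AB(3) B_le by simp
    show "d j = - (F ?k - F (?k - 1))" for j using D D_eq by simp
    show "g - real ?k * (F ?k - F (?k - 1)) + F ?k = 0"
      using 0(1) unfolding W_def D_eq by (simp add: algebra_simps)
  qed
qed

section \<open>The multilinear function on the box\<close>

lemma sym_multilinear_permute:
  fixes x :: "real^'n::finite" and p :: "'n \<Rightarrow> 'n"
  assumes "bij p"
  shows "sym_multilinear c (\<chi> j. x $ p j) = sym_multilinear c x"
proof -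
  have "(\<Sum>J | card J = i. \<Prod>j\<in>J. x $ p j) = (\<Sum>J | card J = i. \<Prod>j\<in>J. x $ j)" for i
  proof (rule sum.reindex_bij_witness[of _ "\<lambda>J. inv p ` J" "\<lambda>J. p ` J"])
    fix J :: "'n set"
    have p: "inj_on p J"
      by (rule inj_on_subset[OF bij_is_inj[OF assms] subset_UNIV])
    have q: "inj_on (inv p) J"
      by (rule inj_on_subset[OF bij_is_inj[OF bij_imp_bij_inv[OF assms]] subset_UNIV])
    show "J \<in> {J. card J = i} \<Longrightarrow> p ` J \<in> {J. card J = i}"
      by (simp add: card_image[OF p])
    show "J \<in> {J. card J = i} \<Longrightarrow> inv p ` J \<in> {J. card J = i}"
      by (simp add: card_image[OF q])
    show "(\<Prod>j\<in>p ` J. x $ j) = (\<Prod>j\<in>J. x $ p j)"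
      by (simp add: prod.reindex[OF p])
    show "inv p ` p ` J = J" by (rule image_inv_f_f[OF bij_is_inj[OF assms]])
    show "p ` inv p ` J = J" by (rule image_f_inv_f[OF bij_is_surj[OF assms]])
  qed
  then show ?thesis by (simp add: sym_multilinear_def)
qed

text \<open>Some permutation of the index set carries \<open>A\<close> to \<open>B\<close>.\<close>

lemma sym_multilinear_vertex_cong:
  fixes A B :: "'n::finite set"
  assumes "card A = card B"
  shows "sym_multilinear c (vertex l u A) = sym_multilinear c (vertex l u B)"
proof -
  have "card (- A) = card (- B)" using assms by (simp add: Compl_eq_Diff_UNIV card_Diff_subset)
  then obtain p q where pq: "bij_betw p A B" "bij_betw q (- A) (- B)"
    using assms finite_same_card_bij by (metis finite)
  define r where "r = (\<lambda>x. if x \<in> A then p x else q x)"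
  have "bij_betw r A B"
    using pq(1) bij_betw_cong[of A r p B] by (simp add: r_def)
  moreover have "bij_betw r (- A) (- B)"
    using pq(2) bij_betw_cong[of "- A" r q "- B"] by (simp add: r_def)
  ultimately have r: "bij_betw r (A \<union> - A) (B \<union> - B)"
    by (rule bij_betw_combine) simp
  have "r j \<in> B \<longleftrightarrow> j \<in> A" for j
    using pq by (auto simp: r_def bij_betw_def)
  then have "vertex l u A = (\<chi> j. vertex l u B $ r j)"
    by (simp add: vertex_def)
  with r sym_multilinear_permute[of r c "vertex l u B"] show ?thesis by simp
qed

lemma sym_multilinear_vertex:
  fixes A :: "'n::{finite,linorder} set"
  shows "sym_multilinear c (vertex l u A)
    = sym_multilinear c (stair_point l u (card A) :: real^'n::{finite,linorder})"
proof -
  have "card A \<le> CARD('n)" by (simp add: card_mono)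
  then show ?thesis
    unfolding stair_point_eq_vertex by (intro sym_multilinear_vertex_cong) (rule card_initial[symmetric])
qed

lemma convex_upto_if_supermodular:
  fixes c :: "nat \<Rightarrow> real"
  assumes "supermodular_on_vertices l u (sym_multilinear c :: real^'n::{finite,linorder} \<Rightarrow> real)"
  shows "convex_upto CARD('n) (\<lambda>k. sym_multilinear c (stair_point l u k :: real^'n::{finite,linorder}))"
  unfolding convex_upto_def
proof (intro allI impI)
  let ?F = "\<lambda>k. sym_multilinear c (stair_point l u k :: real^'n::{finite,linorder})"
  fix k assume k: "k + 2 \<le> CARD('n)"
  then obtain B :: "'n set" where B: "card B = k + 2"
    using obtain_subset_with_card_n by blast
  then obtain r t S where S: "B = insert r (insert t S)" "r \<noteq> t" "r \<notin> S" "t \<notin> S"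
    by (metis Suc_1 add_2_eq_Suc' card_Suc_eq insert_iff)
  then have c: "card S = k" "card (S \<union> {r}) = k + 1" "card (S \<union> {t}) = k + 1"
    "card (S \<union> {r, t}) = k + 2"
    using B by auto
  have "sym_multilinear c (vertex l u (S \<union> {r})) - sym_multilinear c (vertex l u S)
      \<le> sym_multilinear c (vertex l u (S \<union> {r, t})) - sym_multilinear c (vertex l u (S \<union> {t}))"
    using assms S(2-4) unfolding supermodular_on_vertices_def Let_def by blast
  then show "?F (k + 1) - ?F k \<le> ?F (k + 2) - ?F (k + 1)"
    unfolding sym_multilinear_vertex c .
qed

lemma sym_multilinear_affine_in_coordinate:
  fixes x :: "real^'n::finite"
  obtains P Q where "\<And>t. sym_multilinear c (\<chi> j. if j = k then t else x $ j) = P + t * Q"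
proof
  fix t
  have "(\<Prod>j\<in>J. if j = k then t else x $ j)
      = (if k \<in> J then 0 else \<Prod>j\<in>J. x $ j) + t * (if k \<in> J then \<Prod>j\<in>J - {k}. x $ j else 0)"
    for J :: "'n set"
  proof (cases "k \<in> J")
    case True
    have "(\<Prod>j\<in>J. if j = k then t else x $ j) = t * (\<Prod>j\<in>J - {k}. if j = k then t else x $ j)"
      using True by (subst prod.remove[of J k]) auto
    also have "(\<Prod>j\<in>J - {k}. if j = k then t else x $ j) = (\<Prod>j\<in>J - {k}. x $ j)"
      by (rule prod.cong) auto
    finally show ?thesis using True by simp
  next
    case False
    then show ?thesis by (auto intro!: prod.cong)
  qed
  then show "sym_multilinear c (\<chi> j. if j = k then t else x $ j)
      = (\<Sum>i = 2..CARD('n). c i * (\<Sum>J | card J = i. if k \<in> J then 0 else \<Prod>j\<in>J. x $ j))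
      + t * (\<Sum>i = 2..CARD('n). c i * (\<Sum>J | card J = i. if k \<in> J then \<Prod>j\<in>J - {k}. x $ j else 0))"
    unfolding sym_multilinear_def sum_distrib_left
    by (simp add: sum.distrib sum_distrib_left algebra_simps)
qed

definition lifted_vertices :: "real \<Rightarrow> real \<Rightarrow> (real^'n::finite \<Rightarrow> real) \<Rightarrow> ((real^'n) \<times> real) set" where
  "lifted_vertices l u m = range (\<lambda>A. (vertex l u A, m (vertex l u A)))"

text \<open>
  Along each coordinate direction the function is affine, so a point of its graph with a
  coordinate strictly between \<open>l\<close> and \<open>u\<close> lies on a segment of the graph between two points
  where that coordinate is \<open>l\<close> or \<open>u\<close>.
\<close>

lemma graph_point_in_hull_lifted_vertices:
  fixes x :: "real^'n::finite"
  assumes "l < u" "x \<in> box_set l u"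
  shows "(x, sym_multilinear c x) \<in> convex hull lifted_vertices l u (sym_multilinear c)"
  using assms(2)
proof (induction "card {j. x $ j \<notin> {l, u}}" arbitrary: x rule: less_induct)
  case less
  let ?H = "convex hull lifted_vertices l u (sym_multilinear c :: real^'n \<Rightarrow> real)"
  show ?case
  proof (cases "{j. x $ j \<notin> {l, u}} = {}")
    case True
    then have "x = vertex l u {j. x $ j = u}"
      by (auto simp: vertex_def vec_eq_iff)
    then obtain A where "x = vertex l u A" ..
    then have "(x, sym_multilinear c x) \<in> lifted_vertices l u (sym_multilinear c)"
      by (simp add: lifted_vertices_def)
    then show ?thesis by (rule hull_inc)
  next
    case False
    then obtain k where k: "x $ k \<notin> {l, u}" by blast
    define y where "y = (\<lambda>t. \<chi> j. if j = k then t else x $ j)"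
    obtain P Q where PQ: "\<And>t. sym_multilinear c (y t) = P + t * Q"
      using sym_multilinear_affine_in_coordinate unfolding y_def by blast
    have ends: "(y t, sym_multilinear c (y t)) \<in> ?H" if "t \<in> {l, u}" for t
    proof (rule less.hyps)
      show "card {j. y t $ j \<notin> {l, u}} < card {j. x $ j \<notin> {l, u}}"
        using k that by (intro psubset_card_mono) (auto simp: y_def split: if_splits)
      show "y t \<in> box_set l u"
        using less.prems that assms(1) by (auto simp: box_set_def y_def)
    qed
    define s where "s = (x $ k - l) / (u - l)"
    have "l \<le> x $ k" "x $ k \<le> u" using less.prems by (auto simp: box_set_def)
    then have s: "0 \<le> s" "0 \<le> 1 - s" using assms(1) by (auto simp: s_def field_simps)
    have xk: "x $ k = (1 - s) * l + s * u"
    proof -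
      have "s * (u - l) = x $ k - l" using assms(1) by (simp add: s_def)
      then show ?thesis by (simp add: algebra_simps)
    qed
    have x: "x = (1 - s) *\<^sub>R y l + s *\<^sub>R y u"
      by (auto simp: vec_eq_iff y_def xk algebra_simps)
    have "x = y (x $ k)" by (simp add: y_def vec_eq_iff)
    then have "sym_multilinear c x = P + x $ k * Q" using PQ by metis
    also have "\<dots> = (1 - s) * sym_multilinear c (y l) + s * sym_multilinear c (y u)"
      unfolding PQ xk by (simp add: algebra_simps)
    finally have "(x, sym_multilinear c x)
        = (1 - s) *\<^sub>R (y l, sym_multilinear c (y l)) + s *\<^sub>R (y u, sym_multilinear c (y u))"
      using x by simp
    moreover have "(1 - s) *\<^sub>R (y l, sym_multilinear c (y l))
        + s *\<^sub>R (y u, sym_multilinear c (y u)) \<in> ?H"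
      using s ends by (intro convexD[OF convex_convex_hull]) auto
    ultimately show ?thesis by (simp only:)
  qed
qed

lemma hull_graph_eq_hull_lifted_vertices:
  fixes c :: "nat \<Rightarrow> real"
  defines "m \<equiv> sym_multilinear c :: real^'n::finite \<Rightarrow> real"
  assumes "l < u"
  shows "convex hull graph_on_box l u m = convex hull lifted_vertices l u m"
proof
  show "convex hull graph_on_box l u m \<subseteq> convex hull lifted_vertices l u m"
    using graph_point_in_hull_lifted_vertices[OF assms(2)]
    by (intro hull_minimal) (auto simp: graph_on_box_def m_def)
  show "convex hull lifted_vertices l u m \<subseteq> convex hull graph_on_box l u m"
    using assms(2)
    by (intro hull_mono) (auto simp: lifted_vertices_def graph_on_box_def box_set_def vertex_def)
qed

lemma inner_vertex:
  "a \<bullet> vertex l u A = l * (\<Sum>j\<in>UNIV. a $ j) + (u - l) * (\<Sum>j\<in>A. a $ j)"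
proof -
  have "a \<bullet> vertex l u A = (\<Sum>j\<in>UNIV. l * a $ j + (if j \<in> A then (u - l) * a $ j else 0))"
    unfolding inner_vec_def by (intro sum.cong) (auto simp: vertex_def algebra_simps)
  also have "\<dots> = (\<Sum>j\<in>UNIV. l * a $ j) + (\<Sum>j\<in>A. (u - l) * a $ j)"
    by (simp add: sum.distrib flip: sum.inter_filter)
  finally show ?thesis by (simp add: sum_distrib_left)
qed

text \<open>
  If the graph lay in a hyperplane, then \<open>sym_multilinear c\<close> would be affine on the box, and on
  the diagonal of the box it is a polynomial whose coefficient of degree \<open>i\<close> is \<open>c i\<close> times a
  binomial coefficient.
\<close>

lemma aff_dim_graph:
  fixes c :: "nat \<Rightarrow> real"
  assumes "l < u" and c: "\<exists>i\<in>{2..CARD('n::finite)}. c i \<noteq> 0"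
  shows "aff_dim (graph_on_box l u (sym_multilinear c :: real^'n::finite \<Rightarrow> real)) = CARD('n::finite) + 1"
proof (rule ccontr)
  let ?G = "graph_on_box l u (sym_multilinear c :: real^'n \<Rightarrow> real)"
  assume "\<not> ?thesis"
  then have "aff_dim ?G < DIM((real^'n) \<times> real)"
    using aff_dim_le_DIM[of ?G] by simp
  then obtain a d where a: "a \<noteq> 0" "?G \<subseteq> {p. a \<bullet> p = d}"
    by (rule aff_lowdim_subset_hyperplane)
  obtain b s where bs: "a = (b, s)" by (cases a)
  have eq: "b \<bullet> x + s * sym_multilinear c x = d" if "x \<in> box_set l u" for x
    using a(2) that by (auto simp: graph_on_box_def bs)
  let ?N = "CARD('n)"
  \<comment> \<open>The coefficients of the hyperplane equation, restricted to the diagonal.\<close>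
  define e where "e = (\<lambda>i. if i = 0 then - d else if i = 1 then (\<Sum>j\<in>UNIV. b $ j)
    else s * c i * real (?N choose i))"
  have N: "2 \<le> ?N" using c by auto
  have "(\<Sum>i\<le>?N. e i * t ^ i) = 0" if t: "t \<in> {l..u}" for t
  proof -
    have "card {J :: 'n set. card J = i} = ?N choose i" for i
      using n_subsets[of "UNIV :: 'n set" i] by simp
    then have m: "sym_multilinear c (\<chi> j::'n. t)
        = (\<Sum>i = 2..?N. c i * (real (?N choose i) * t ^ i))"
      by (simp add: sym_multilinear_def)
    have "{..?N} = insert 0 (insert 1 {2..?N})" using N by auto
    then have "(\<Sum>i\<le>?N. e i * t ^ i) = e 0 + e 1 * t + (\<Sum>i = 2..?N. e i * t ^ i)"
      by simp
    also have "(\<Sum>i = 2..?N. e i * t ^ i) = s * sym_multilinear c (\<chi> j::'n. t)"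
      unfolding m sum_distrib_left by (rule sum.cong) (auto simp: e_def)
    also have "e 1 * t = b \<bullet> (\<chi> j. t)"
      by (simp add: e_def inner_vec_def sum_distrib_right)
    finally show ?thesis
      using eq[of "\<chi> j. t"] t by (simp add: e_def box_set_def)
  qed
  then have "{l..u} \<subseteq> {t. (\<Sum>i\<le>?N. e i * t ^ i) = 0}" by blast
  then have "infinite {t. (\<Sum>i\<le>?N. e i * t ^ i) = 0}"
    using infinite_Icc[OF assms(1)] infinite_super by blast
  then have e: "e i = 0" if "i \<le> ?N" for i
    using that by (auto simp: polyfun_finite_roots)
  obtain i where i: "i \<in> {2..?N}" "c i \<noteq> 0" using c by blast
  then have "s = 0" using e[of i] by (auto simp: e_def)
  have "b $ j = 0" for j
  proof -
    have v: "vertex l u A \<in> box_set l u" for A :: "'n set"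
      using assms(1) by (auto simp: vertex_def box_set_def)
    from eq[OF v[of "{j}"]] eq[OF v[of "{}"]] show ?thesis
      using assms(1) by (simp add: \<open>s = 0\<close> inner_vertex)
  qed
  then have "a = 0" using \<open>s = 0\<close> by (simp add: bs vec_eq_iff zero_prod_def)
  with a(1) show False ..
qed

section \<open>Facets and tight sets\<close>

text \<open>
  A valid inequality that involves the last coordinate cuts out a hyperplane that projects
  isomorphically to the remaining coordinates.  So its face is a facet exactly if the projected
  tight generators lie in no hyperplane.
\<close>

lemma facet_of_hull_iff:
  fixes V :: "('a::euclidean_space \<times> real) set" and b :: 'a and s b0 :: real
  defines "L \<equiv> (\<lambda>p. b0 + (b, s) \<bullet> p)"
  assumes "finite V" and dim: "aff_dim (convex hull V) = DIM('a) + 1"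
    and s: "s \<noteq> 0" and nonneg: "\<And>p. p \<in> V \<Longrightarrow> 0 \<le> L p"
  shows "{p \<in> convex hull V. L p = 0} facet_of convex hull V
    \<longleftrightarrow> (\<forall>a d. (\<forall>p\<in>V. L p = 0 \<longrightarrow> a \<bullet> fst p = d) \<longrightarrow> a = 0)"
proof -
  let ?P = "convex hull V"
  let ?H = "{p. (b, s) \<bullet> p = - b0}"
  let ?F = "{p \<in> ?P. L p = 0}"
  have LH: "L p = 0 \<longleftrightarrow> p \<in> ?H" for p by (auto simp: L_def)
  then have F_eq: "?F = ?P \<inter> ?H" by blast
  have dimH: "aff_dim ?H = DIM('a)"
    using s by (subst aff_dim_hyperplane) (auto simp: zero_prod_def)
  have "V \<subseteq> {p. (b, s) \<bullet> p \<ge> - b0}" using nonneg by (fastforce simp: L_def)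
  then have "?P \<subseteq> {p. (b, s) \<bullet> p \<ge> - b0}"
    by (rule hull_minimal) (rule convex_halfspace_ge)
  then have face: "?F face_of ?P"
    unfolding F_eq by (intro face_of_Int_supporting_hyperplane_ge) auto
  show ?thesis
  proof (intro iffI allI impI)
    fix a d assume facet: "?F facet_of ?P" and vanish: "\<forall>p\<in>V. L p = 0 \<longrightarrow> a \<bullet> fst p = d"
    \<comment> \<open>A facet spans \<open>?H\<close>, so an equation of the tight generators that does not involve the last
      coordinate holds on all of \<open>?H\<close>, which projects onto the whole space.\<close>
    let ?A = "{p. (a, 0 :: real) \<bullet> p = d}"
    obtain S where S: "S \<subseteq> V" "?F = convex hull S"
      using face_of_convex_hull_subset[OF finite_imp_compact[OF \<open>finite V\<close>] face] by blast
    have "S \<subseteq> ?F" unfolding S(2) by (rule hull_subset)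
    then have "S \<subseteq> ?A" using S(1) vanish by (auto simp: inner_prod_def)
    then have "?F \<subseteq> ?A" unfolding S(2) by (rule hull_minimal) (rule convex_hyperplane)
    then have FA: "affine hull ?F \<subseteq> ?A" by (rule hull_minimal) (rule affine_hyperplane)
    have "affine hull ?F = ?H"
    proof (rule affine_dim_equal)
      show "affine hull ?F \<subseteq> ?H" unfolding F_eq by (intro hull_minimal affine_hyperplane) auto
      show "affine hull ?F \<noteq> {}" using facet by (auto simp: facet_of_def)
      show "aff_dim (affine hull ?F) = aff_dim ?H"
        using facet dim dimH by (simp add: facet_of_def)
    qed (auto intro: affine_hyperplane)
    with FA have HA: "?H \<subseteq> ?A" by simp
    have "a \<bullet> x = d" for x
    proof -
      have "(x, (- b0 - b \<bullet> x) / s) \<in> ?H" using s by simp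
      with HA have "(x, (- b0 - b \<bullet> x) / s) \<in> ?A" by (rule subsetD)
      then show ?thesis by simp
    qed
    from this[of a] this[of 0] show "a = 0" by simp
  next
    assume span: "\<forall>a d. (\<forall>p\<in>V. L p = 0 \<longrightarrow> a \<bullet> fst p = d) \<longrightarrow> a = 0"
    have "V \<inter> ?H \<subseteq> ?F" unfolding F_eq using hull_subset[of V] by blast
    have "\<not> aff_dim (fst ` ?F) < DIM('a)"
    proof
      assume "aff_dim (fst ` ?F) < DIM('a)"
      then obtain a d where a: "a \<noteq> 0" "fst ` ?F \<subseteq> {x. a \<bullet> x = d}"
        by (rule aff_lowdim_subset_hyperplane)
      then have "\<forall>p\<in>V. L p = 0 \<longrightarrow> a \<bullet> fst p = d"
        using \<open>V \<inter> ?H \<subseteq> ?F\<close> LH by blast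
      with span a(1) show False by blast
    qed
    moreover have "aff_dim (fst ` ?F) \<le> aff_dim ?F"
      by (rule aff_dim_linear_image_le) (rule linear_fst)
    moreover have "aff_dim ?F \<le> DIM('a)"
      using aff_dim_subset[of ?F ?H] dimH F_eq by simp
    ultimately have "aff_dim ?F = DIM('a)" by simp
    moreover from this have "?F \<noteq> {}" using aff_dim_empty by force
    ultimately show "?F facet_of ?P" using face dim by (simp add: facet_of_def)
  qed
qed

definition affine_form :: "real \<Rightarrow> 'a::real_inner \<Rightarrow> real \<Rightarrow> 'a \<times> real \<Rightarrow> real" where
  "affine_form b0 b s p = b0 + (b, s) \<bullet> p"

lemma affine_form_vertex:
  "affine_form b0 b s (vertex l u A, y)
    = (b0 + l * (\<Sum>j\<in>UNIV. b $ j)) + (\<Sum>j\<in>A. (u - l) * b $ j) + s * y"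
  by (simp add: affine_form_def inner_vertex sum_distrib_left)

lemma core_inequality_iff:
  "core_inequality L \<longleftrightarrow> (\<exists>b0 b s. s \<in> {-1, 1} \<and> mono (($) b) \<and> L = affine_form b0 b s)"
  by (simp add: core_inequality_def affine_form_def[abs_def] inner_vec_def inner_prod_def mono_def
      case_prod_unfold add.assoc)

text \<open>
  Validity and tightness only have to be tested on the lifted vertices, so being a core facet
  becomes a property of the slack as a set function of \<open>A\<close>.
\<close>

lemma core_facet_iff_spanning:
  fixes c :: "nat \<Rightarrow> real" and l u :: real
  defines "m \<equiv> sym_multilinear c :: real^'n::{finite,linorder} \<Rightarrow> real"
  defines "P \<equiv> convex hull graph_on_box l u m"
  defines "h \<equiv> (\<lambda>L A. L (vertex l u A, m (vertex l u A)) :: real)"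
  assumes lu: "l < u" and c: "\<exists>i\<in>{2..CARD('n)}. c i \<noteq> 0"
  shows "core_facet P L \<longleftrightarrow> core_inequality L \<and> (\<forall>A. 0 \<le> h L A) \<and> spanning {A. h L A = 0}"
proof (cases "core_inequality L")
  case True
  then obtain b0 b s where L: "L = affine_form b0 b s" and s: "s \<noteq> 0"
    unfolding core_inequality_iff by auto
  let ?V = "lifted_vertices l u m"
  have P: "P = convex hull ?V"
    using hull_graph_eq_hull_lifted_vertices[OF lu] by (simp add: P_def m_def)
  have "aff_dim P = DIM(real^('n::{finite,linorder})) + 1"
    using aff_dim_graph[OF lu c] by (simp add: P_def m_def aff_dim_convex_hull)
  then have dim: "aff_dim (convex hull ?V) = DIM(real^('n::{finite,linorder})) + 1"
    unfolding P .
  have fin: "finite ?V" by (simp add: lifted_vertices_def)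
  have valid: "(\<forall>p\<in>P. 0 \<le> L p) \<longleftrightarrow> (\<forall>A. 0 \<le> h L A)"
  proof
    assume "\<forall>p\<in>P. 0 \<le> L p"
    moreover have "?V \<subseteq> P" unfolding P by (rule hull_subset)
    ultimately show "\<forall>A. 0 \<le> h L A" by (auto simp: h_def lifted_vertices_def)
  next
    assume "\<forall>A. 0 \<le> h L A"
    then have "0 \<le> b0 + (b, s) \<bullet> (vertex l u A, m (vertex l u A))" for A
      unfolding h_def L affine_form_def by blast
    then have "- b0 \<le> (b, s) \<bullet> (vertex l u A, m (vertex l u A))" for A
      by (smt (verit, best))
    then have "?V \<subseteq> {p. (b, s) \<bullet> p \<ge> - b0}"
      unfolding lifted_vertices_def by blast
    then have "P \<subseteq> {p. (b, s) \<bullet> p \<ge> - b0}"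
      unfolding P by (rule hull_minimal) (rule convex_halfspace_ge)
    then show "\<forall>p\<in>P. 0 \<le> L p" by (fastforce simp: L affine_form_def)
  qed
  have "{p \<in> P. L p = 0} facet_of P \<longleftrightarrow> spanning {A. h L A = 0}" if nonneg: "\<forall>A. 0 \<le> h L A"
  proof -
    have "{p \<in> P. L p = 0} facet_of P
        \<longleftrightarrow> (\<forall>a d. (\<forall>p\<in>?V. L p = 0 \<longrightarrow> a \<bullet> fst p = d) \<longrightarrow> a = 0)"
      unfolding P L affine_form_def
      by (rule facet_of_hull_iff[OF fin dim s])
        (use nonneg in \<open>auto simp: h_def L affine_form_def lifted_vertices_def\<close>)
    also have "\<dots> \<longleftrightarrow> (\<forall>a d. (\<forall>A. h L A = 0 \<longrightarrow> a \<bullet> vertex l u A = d) \<longrightarrow> a = 0)"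
      by (simp add: lifted_vertices_def h_def)
    also have "\<dots> \<longleftrightarrow> spanning {A. h L A = 0}"
    proof (intro iffI allI impI)
      assume *: "\<forall>a d. (\<forall>A. h L A = 0 \<longrightarrow> a \<bullet> vertex l u A = d) \<longrightarrow> a = 0"
      show "spanning {A. h L A = 0}"
        unfolding spanning_def
      proof (intro allI impI)
        fix a :: "'n \<Rightarrow> real" and d j assume "\<forall>A\<in>{A. h L A = 0}. sum a A = d"
        then have "\<forall>A. h L A = 0 \<longrightarrow> (\<chi> j. a j) \<bullet> vertex l u A = l * sum a UNIV + (u - l) * d"
          by (simp add: inner_vertex)
        with * have "(\<chi> j. a j) = 0" by blast
        then show "a j = 0" by (simp add: vec_eq_iff)
      qed
    next
      fix a :: "real^'n::{finite,linorder}" and d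
      assume span: "spanning {A. h L A = 0}"
        and "\<forall>A. h L A = 0 \<longrightarrow> a \<bullet> vertex l u A = d"
      then have "\<forall>A\<in>{A. h L A = 0}. sum (($) a) A = (d - l * sum (($) a) UNIV) / (u - l)"
        using lu by (auto simp: inner_vertex field_simps)
      with span have "\<forall>j. a $ j = 0" unfolding spanning_def by blast
      then show "a = 0" by (simp add: vec_eq_iff)
    qed
    finally show ?thesis .
  qed
  with True valid show ?thesis unfolding core_facet_def by auto
qed (simp add: core_facet_def)

section \<open>The listed inequalities\<close>

lemma upper_ineq_eq_affine_form:
  fixes m :: "real^'n::{finite,linorder} \<Rightarrow> real" and l u :: real
  defines "F \<equiv> \<lambda>k. m (stair_point l u k)"
  shows "upper_ineq l u m = affine_form ((u * F 0 - l * F CARD('n)) / (u - l))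
    (\<chi> j. (F (index j) - F (index j - 1)) / (u - l)) (- 1)"
  by (auto simp: fun_eq_iff upper_ineq_def affine_form_def F_def inner_vec_def)

lemma lower_ineq_eq_affine_form:
  fixes m :: "real^'n::{finite,linorder} \<Rightarrow> real" and l u :: real
  defines "F \<equiv> \<lambda>k. m (stair_point l u k)"
  shows "lower_ineq l u m k = affine_form
    (- F k + (F k - F (k - 1)) / (u - l) * (real k * u + (real CARD('n) - real k) * l))
    (\<chi> j. - ((F k - F (k - 1)) / (u - l))) 1"
  by (auto simp: fun_eq_iff lower_ineq_def affine_form_def F_def inner_vec_def right_diff_distrib
      sum_distrib_left sum_negf)

lemma sum_initial_increments:
  fixes F :: "nat \<Rightarrow> real"
  assumes "k \<le> CARD('n)"
  shows "(\<Sum>j\<in>(initial k :: 'n::{finite,linorder} set). F (index j) - F (index j - 1)) = F k - F 0"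
  using sum_initial[OF assms, of "\<lambda>i. F i - F (i - 1)"] sum_telescope''[of 0 k F] by simp

text \<open>
  The slack at \<open>A\<close> compares the increments of \<open>F\<close> selected by \<open>A\<close> with the first \<open>card A\<close> ones,
  which telescope to \<open>F (card A) - F 0\<close>.
\<close>

lemma upper_ineq_vertex:
  fixes c :: "nat \<Rightarrow> real" and l u :: real
  defines "m \<equiv> sym_multilinear c :: real^'n::{finite,linorder} \<Rightarrow> real"
  defines "F \<equiv> \<lambda>k. m (stair_point l u k)"
  assumes "l < u"
  shows "upper_ineq l u m (vertex l u A, m (vertex l u A))
    = F 0 + (\<Sum>j\<in>A. F (index j) - F (index j - 1)) - F (card A)"
proof -
  have "(\<Sum>j\<in>(UNIV :: 'n set). (F (index j) - F (index j - 1)) / (u - l))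
      = (F CARD('n) - F 0) / (u - l)"
    using sum_initial_increments[where 'n='n, of "CARD('n)" F] by (simp flip: sum_divide_distrib)
  moreover have "(u * F 0 - l * F CARD('n)) / (u - l) + l * ((F CARD('n) - F 0) / (u - l)) = F 0"
  proof -
    have "u - l \<noteq> 0" using assms(3) by simp
    then show ?thesis by (simp add: divide_simps) (simp add: algebra_simps)
  qed
  moreover have "m (vertex l u A) = F (card A)"
    unfolding m_def F_def by (rule sym_multilinear_vertex)
  moreover have "m (stair_point l u i) = F i" for i by (simp add: F_def)
  ultimately show ?thesis
    using assms(3) unfolding upper_ineq_eq_affine_form affine_form_vertex by simp
qed

text \<open>
  On vertices the lower bound is the line through the points of index \<open>k - 1\<close> and \<open>k\<close> of the
  graph of \<open>F\<close>, evaluated at \<open>card A\<close>.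
\<close>

lemma lower_ineq_vertex:
  fixes c :: "nat \<Rightarrow> real" and l u :: real
  defines "m \<equiv> sym_multilinear c :: real^'n::{finite,linorder} \<Rightarrow> real"
  defines "F \<equiv> \<lambda>k. m (stair_point l u k)"
  assumes "l < u"
  shows "lower_ineq l u m k (vertex l u A, m (vertex l u A))
    = F (card A) - (F k + (F k - F (k - 1)) * (real (card A) - real k))"
proof -
  define D where "D = (F k - F (k - 1)) / (u - l)"
  have D: "F k - F (k - 1) = D * (u - l)" using assms(3) by (simp add: D_def)
  have vertex: "m (vertex l u A) = F (card A)"
    unfolding m_def F_def by (rule sym_multilinear_vertex)
  have stair: "m (stair_point l u i) = F i" for i by (simp add: F_def)
  show ?thesis
    unfolding lower_ineq_eq_affine_form affine_form_vertex stair vertex D_def[symmetric]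
    unfolding D
    by (simp add: algebra_simps)
qed

theorem theorem5p1:
  fixes l u :: real and c :: "nat \<Rightarrow> real"
    and m :: "real^'n::{finite,linorder} \<Rightarrow> real"
    and P :: "((real^'n::{finite,linorder}) \<times> real) set"
  assumes "CARD('n) \<ge> 2"
    and "l < u"
    and "\<exists>i\<in>{2..CARD('n)}. c i \<noteq> 0"
    and "m = sym_multilinear c"
    and "P = convex hull (graph_on_box l u m)"
    and "supermodular_on_vertices l u m"
  shows "{L. core_facet P L} = {upper_ineq l u m} \<union> {lower_ineq l u m k | k. k \<in> {1..CARD('n)}}
       \<and> finite {L. core_facet P L} \<and> card {L. core_facet P L} \<le> CARD('n) + 1"
proof -
  define F where "F = (\<lambda>k. m (stair_point l u k))"
  define h where "h = (\<lambda>L A. L (vertex l u A, m (vertex l u A)) :: real)"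
  have conv: "convex_upto CARD('n) F"
    using convex_upto_if_supermodular[where 'n='n] assms(4,6) by (simp add: F_def)
  have mF: "m (vertex l u A) = F (card A)" for A
    unfolding assms(4) F_def by (rule sym_multilinear_vertex)
  have stair: "m (stair_point l u k) = F k" for k by (simp add: F_def)
  have facet_iff: "core_facet P L
      \<longleftrightarrow> core_inequality L \<and> (\<forall>A. 0 \<le> h L A) \<and> spanning {A. h L A = 0}" for L
    using core_facet_iff_spanning[OF assms(2,3), of L] by (simp add: assms(4,5) h_def)
  have h_upper: "h (upper_ineq l u m) A
      = F 0 + (\<Sum>j\<in>A. F (index j) - F (index j - 1)) - F (card A)" for A
    using upper_ineq_vertex[OF assms(2)] by (simp add: h_def F_def assms(4))
  have h_lower: "h (lower_ineq l u m k) A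
      = F (card A) - (F k + (F k - F (k - 1)) * (real (card A) - real k))" for k A
    using lower_ineq_vertex[OF assms(2)] by (simp add: h_def F_def assms(4))
  have mono_F: "mono (\<lambda>j::'n. F (index j) - F (index j - 1))"
  proof (rule monoI)
    fix i j :: 'n assume "i \<le> j"
    then have "index i \<le> index j" using strict_mono_index strict_mono_less_eq by blast
    then show "F (index i) - F (index i - 1) \<le> F (index j) - F (index j - 1)"
      using convex_upto_step_mono[OF conv, of "index i - 1" "index j - 1"]
        index_bounds[of i] index_bounds[of j] by simp
  qed

  have "core_facet P (upper_ineq l u m)"
    unfolding facet_iff
  proof (intro conjI allI)
    show "core_inequality (upper_ineq l u m)"
      unfolding upper_ineq_eq_affine_form core_inequality_iff stair
      using mono_F assms(2)
      by (intro exI conjI) (auto simp: mono_def divide_right_mono)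
    have le: "card A \<le> CARD('n)" for A :: "'n set" by (simp add: card_mono)
    show "0 \<le> h (upper_ineq l u m) A" for A
      using sum_initial_le[OF mono_F, of A] sum_initial_increments[OF le, of F A]
      by (simp add: h_upper)
    have "h (upper_ineq l u m) (initial k) = 0" if "k \<le> CARD('n)" for k
      using that sum_initial_increments[OF that, of F] by (simp add: h_upper card_initial)
    then have "h (upper_ineq l u m) (initial (index j)) = 0"
      "h (upper_ineq l u m) (initial (index j - 1)) = 0" for j :: 'n
      using index_bounds[of j] by auto
    then have "j \<notin> initial (index j - 1) \<and> initial (index j - 1) \<in> {A. h (upper_ineq l u m) A = 0}
        \<and> insert j (initial (index j - 1)) \<in> {A. h (upper_ineq l u m) A = 0}" for j
      unfolding initial_index_eq(1)[symmetric] using initial_index_eq(2) by blast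
    then show "spanning {A. h (upper_ineq l u m) A = 0}"
      by (intro spanningI_insert) blast
  qed

  moreover have "core_facet P (lower_ineq l u m k)" if k: "k \<in> {1..CARD('n)}" for k
    unfolding facet_iff
  proof (intro conjI allI)
    show "core_inequality (lower_ineq l u m k)"
      unfolding lower_ineq_eq_affine_form core_inequality_iff
      by (intro exI conjI) (auto simp: mono_def)
    show "0 \<le> h (lower_ineq l u m k) A" for A
      using convex_upto_tangent[OF conv k, of "card A"] by (simp add: h_lower card_mono)
    have tight: "h (lower_ineq l u m k) A = 0" if "card A \<in> {k - 1, k}" for A
      using that k by (auto simp: h_lower of_nat_diff)
    show "spanning {A. h (lower_ineq l u m k) A = 0}"
    proof (rule spanningI_insert)
      \<comment> \<open>All sets of the sizes \<open>k - 1\<close> and \<open>k\<close> are tight.\<close>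
      fix j :: 'n
      have "k - 1 \<le> card (UNIV - {j})" using k by (simp add: diff_le_mono)
      from obtain_subset_with_card_n[OF this]
      obtain A where A: "A \<subseteq> UNIV - {j}" "card A = k - 1" by metis
      then have "j \<notin> A" by blast
      then show "\<exists>A. j \<notin> A \<and> A \<in> {A. h (lower_ineq l u m k) A = 0}
          \<and> insert j A \<in> {A. h (lower_ineq l u m k) A = 0}"
        using tight[of A] tight[of "insert j A"] A(2) k by auto
    qed
  qed

  moreover have "L \<in> {upper_ineq l u m} \<union> {lower_ineq l u m k | k. k \<in> {1..CARD('n)}}"
    if facet: "core_facet P L" for L
  proof -
    obtain b0 b s where s: "s \<in> {-1, 1}" and mono: "mono (($) b)" and L: "L = affine_form b0 b s"
      using facet unfolding facet_iff core_inequality_iff by blast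
    define g where "g = b0 + l * (\<Sum>j\<in>UNIV. b $ j)"
    define d where "d = (\<lambda>j. (u - l) * b $ j)"
    have b_eq: "b $ j = d j / (u - l)" for j using assms(2) by (simp add: d_def)
    have hL: "h L A = g + sum d A + s * F (card A)" for A
      unfolding h_def L affine_form_vertex g_def d_def mF ..
    have nonneg: "0 \<le> h L A" for A
      using facet unfolding facet_iff by blast
    have span: "spanning {A. h L A = 0}"
      using facet unfolding facet_iff by blast
    from s consider "s = - 1" | "s = 1" by blast
    then show ?thesis
    proof cases
      case 1
      have hL: "h L A = g + sum d A - F (card A)" for A by (simp add: hL 1)
      have mono_d: "mono d" using mono assms(2) by (auto simp: d_def mono_def)
      have tight: "h L (initial k) = 0" if "k \<le> CARD('n)" for k
        using tight_initial_if_spanning[OF conv mono_d, of g k] nonneg span that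
        unfolding hL by blast
      \<comment> \<open>Two tight initial segments that differ by \<open>j\<close> determine the coefficient of \<open>j\<close>.\<close>
      have d_eq: "d j = F (index j) - F (index j - 1)" for j
      proof -
        have "index j - 1 \<le> CARD('n)" "index j \<le> CARD('n)" using index_bounds[of j] by auto
        then have "h L (initial (index j)) = 0" "h L (initial (index j - 1)) = 0"
          "card (initial (index j) :: 'n set) = index j"
          "card (initial (index j - 1) :: 'n set) = index j - 1"
          by (auto intro: tight card_initial)
        moreover have "sum d (initial (index j)) = d j + sum d (initial (index j - 1))"
          using initial_index_eq[of j] by simp
        ultimately show ?thesis unfolding hL by simp
      qed
      have "(\<Sum>j\<in>UNIV. b $ j) = (F CARD('n) - F 0) / (u - l)"
        using sum_initial_increments[where 'n='n, of "CARD('n)" F]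
        by (simp add: b_eq d_eq flip: sum_divide_distrib)
      moreover have "g = F 0" using tight[of 0] by (simp add: hL)
      ultimately have "b0 = F 0 - l * ((F CARD('n) - F 0) / (u - l))" by (simp add: g_def)
      then have "b0 = (u * F 0 - l * F CARD('n)) / (u - l)"
        using assms(2) by (simp add: field_simps)
      moreover have "b = (\<chi> j. (F (index j) - F (index j - 1)) / (u - l))"
        by (simp add: vec_eq_iff b_eq d_eq)
      ultimately have "L = upper_ineq l u m"
        unfolding L upper_ineq_eq_affine_form stair 1 by simp
      then show ?thesis by simp
    next
      case 2
      have hL: "h L A = g + sum d A + F (card A)" for A by (simp add: hL 2)
      obtain k where k: "k \<in> {1..CARD('n)}" and d_eq: "\<And>j. d j = - (F k - F (k - 1))"
        and g_eq: "g - real k * (F k - F (k - 1)) + F k = 0"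
        using tight_sizes_if_spanning[OF conv, of g d] nonneg span unfolding hL by blast
      define D where "D = (F k - F (k - 1)) / (u - l)"
      have D: "F k - F (k - 1) = D * (u - l)" using assms(2) by (simp add: D_def)
      have b: "b = (\<chi> j. - D)"
        using assms(2) unfolding vec_eq_iff b_eq d_eq D by simp
      then have "g = b0 - real CARD('n) * l * D" by (simp add: g_def)
      then have "b0 = - F k + D * (real k * u + (real CARD('n) - real k) * l)"
        using g_eq unfolding D by (simp add: algebra_simps)
      then have "L = lower_ineq l u m k"
        unfolding L lower_ineq_eq_affine_form stair D_def[symmetric] 2 b by simp
      with k show ?thesis by blast
    qed
  qed

  ultimately have facets: "{L. core_facet P L}
      = {upper_ineq l u m} \<union> {lower_ineq l u m k | k. k \<in> {1..CARD('n)}}"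
    by blast
  have image: "{lower_ineq l u m k | k. k \<in> {1..CARD('n)}} = lower_ineq l u m ` {1..CARD('n)}"
    by blast
  have "card ({upper_ineq l u m} \<union> lower_ineq l u m ` {1..CARD('n)})
      \<le> 1 + card (lower_ineq l u m ` {1..CARD('n)})"
    using card_Un_le[of "{upper_ineq l u m}"] by simp
  also have "\<dots> \<le> CARD('n) + 1"
    using card_image_le[of "{1..CARD('n)}" "lower_ineq l u m"] by simp
  finally show ?thesis unfolding facets image by simp
qed

end
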